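(* Let $d, N$ be integers with $2 \leq d < N$, let $0 < c_1 < c_2$ be real numbers, and let $\sigma \geq 0$ satisfy $\sigma \leq c_1 \sqrt{(N-d)/d}$. Then there is a uniform tight frame of $N$ vectors in $\mathbb{R}^d$ of norm $\sqrt{c_1}$ which maximizes $$\min_{1 \leq k \leq N} \frac{|v_k|^2}{\sigma^2 + \sum_{l \neq k} \langle v_k, v_l \rangle^2}$$ among all uniform vector systems $(v_i)_{i=1}^N \subset \sqrt{c}\, S^{d-1}$ with $c_1 \leq c \leq c_2$ (where $c$ may vary from system to system).
   Context: $|\cdot|$ and $\langle \cdot,\cdot\rangle$ are the Euclidean norm and inner product on $\mathbb{R}^d$, and $S^{d-1}$ is the Euclidean unit sphere of $\mathbb{R}^d$. Sums $\sum_{l \neq k}$ run over $l \in \{1,\ldots,N\}\setminus\{k\}$. Convention: a positive number divided by $0$ equals $+\infty$. Vector systems are indexed families (repetitions are allowed). A vector system is uniform if all of its vectors have the same positive norm. For $u,v \in \mathbb{R}^d$, $u \otimes v$ is the linear map $z \mapsto u\langle z, v\rangle$. A system $v_1,\ldots,v_N \in \mathbb{R}^d$ is a uniform tight frame of norm $c>0$ if $|v_k| = c$ for every $k$ and $\sum_{k=1}^N v_k \otimes v_k = \frac{N c^2}{d} I_d$, where $I_d$ is the identity on $\mathbb{R}^d$. *)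

theory Defs
  imports "HOL-Analysis.Analysis" "HOL-Library.Extended_Real"
begin

text \<open>
  A system of \<open>N\<close> vectors is a function on \<open>nat\<close> of which only the values at the
  indices \<open>1, \<dots>, N\<close> matter; repetitions are allowed.
\<close>

definition uniform_system :: "nat \<Rightarrow> (nat \<Rightarrow> real ^ 'd) \<Rightarrow> bool" where
  "uniform_system N v \<longleftrightarrow> (\<exists>r>0. \<forall>k\<in>{1..N}. norm (v k) = r)"

definition rank_one :: "real ^ 'd \<Rightarrow> real ^ 'd \<Rightarrow> (real ^ 'd \<Rightarrow> real ^ 'd)" where
  "rank_one u v = (\<lambda>z. (z \<bullet> v) *\<^sub>R u)"

definition uniform_tight_frame :: "nat \<Rightarrow> real \<Rightarrow> (nat \<Rightarrow> real ^ 'd) \<Rightarrow> bool" where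
  "uniform_tight_frame N c v \<longleftrightarrow>
     c > 0 \<and>
     (\<forall>k\<in>{1..N}. norm (v k) = c) \<and>
     (\<lambda>z. \<Sum>k=1..N. rank_one (v k) (v k) z) =
       (\<lambda>z. (real N * c\<^sup>2 / real CARD('d)) *\<^sub>R z)"

definition admissible_systems :: "nat \<Rightarrow> real \<Rightarrow> real \<Rightarrow> (nat \<Rightarrow> real ^ 'd) set" where
  "admissible_systems N c1 c2 =
     {v. uniform_system N v \<and> (\<exists>c\<in>{c1..c2}. \<forall>k\<in>{1..N}. v k \<in> sphere 0 (sqrt c))}"

text \<open>
  The quotient is taken in \<^typ>\<open>ereal\<close>, so that it is \<open>\<infinity>\<close> when the denominator
  vanishes; in \<^typ>\<open>real\<close> it would be \<open>0\<close>.
\<close>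

definition min_ratio :: "nat \<Rightarrow> real \<Rightarrow> (nat \<Rightarrow> real ^ 'd) \<Rightarrow> ereal" where
  "min_ratio N \<sigma> v =
     (MIN k\<in>{1..N}.
        ereal ((norm (v k))\<^sup>2) / ereal (\<sigma>\<^sup>2 + (\<Sum>l\<in>{1..N} - {k}. (v k \<bullet> v l)\<^sup>2)))"

lemma ereal_pos_divide_zero: "x > 0 \<Longrightarrow> ereal x / ereal 0 = \<infinity>"
  by (simp add: divide_ereal_def)

end

theory Submission
  imports Defs
begin

text \<open>
  The Cauchy--Schwarz inequality bounds the frame potential \<open>\<Sum>\<^bsub>k,l\<^esub> \<langle>v\<^sub>k, v\<^sub>l\<rangle>\<^sup>2\<close> of \<open>N\<close> vectors of norm
  \<open>\<surd>c\<close> below by \<open>N\<^sup>2 c\<^sup>2 / d\<close>, so some \<open>k\<close> has interference at least \<open>c\<^sup>2 (N - d) / d\<close>; a uniform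
  tight frame attains this bound at every \<open>k\<close>. The resulting bound \<open>c / (\<sigma>\<^sup>2 + c\<^sup>2 (N - d) / d)\<close> on
  the minimum is decreasing in \<open>c \<ge> c\<^sub>1\<close> by the hypothesis on \<open>\<sigma>\<close>. Tight frames are obtained from
  the discrete Hartley transform: the coordinates of \<open>v\<^sub>k\<close> are multiples of
  \<open>cos (2 \<pi> j k / N) + sin (2 \<pi> j k / N)\<close>, with \<open>j\<close> running over a set of \<open>d\<close> integers that is
  symmetric (so that all \<open>v\<^sub>k\<close> have the same norm) and pairwise incongruent modulo \<open>N\<close>
  (so that the coordinates are orthogonal).
\<close>

section \<open>Discrete Hartley orthogonality and the construction of tight frames\<close>

lemma sum_cis_multiples:
  fixes m :: int
  assumes "0 < N"
  shows "(\<Sum>k=1..N. cis (2 * pi * m * real k / N)) = (if int N dvd m then of_nat N else 0)"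
proof -
  \<comment> \<open>An \<open>N\<close>-th root of unity, equal to 1 exactly when \<open>N\<close>
    divides \<open>m\<close>; otherwise its geometric sum vanishes.\<close>
  define z where "z = cis (2 * pi * m / N)"
  have pow: "cis (2 * pi * m * real k / N) = z ^ k" for k :: nat
    unfolding z_def by (simp add: Complex.DeMoivre field_simps)
  have zN: "z ^ N = 1"
    using pow[of N] assms cis_multiple_2pi[of "of_int m"] by simp
  have z1: "z = 1 \<longleftrightarrow> int N dvd m"
  proof
    assume "z = 1"
    then have "cos (2 * pi * m / N) = 1"
      unfolding z_def by (metis cis.simps(1) one_complex.simps(1))
    then obtain n :: int where "2 * pi * m / N = n * 2 * pi"
      using cos_one_2pi_int by auto
    then have "real_of_int m = of_int (n * int N)"
      using assms by (simp add: field_simps)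
    then show "int N dvd m"
      using of_int_eq_iff by (metis dvd_triv_right)
  next
    assume "int N dvd m"
    then obtain n where "m = int N * n" ..
    then show "z = 1"
      unfolding z_def using assms cis_multiple_2pi[of "of_int n"] by (simp add: mult.assoc)
  qed
  have "(\<Sum>k=1..N. z ^ k) = z * (\<Sum>k<N. z ^ k)"
    by (simp add: sum_distrib_left sum.atLeast1_atMost_eq)
  then show ?thesis
    using z1 zN geometric_sum[of z N] by (auto simp: pow)
qed

lemma cas_mult: "(cos a + sin a) * (cos b + sin b) = cos (a - b) + sin (a + b :: real)"
  by (simp add: cos_diff sin_add algebra_simps)

text \<open>By \<open>cas_mult\<close> the sum is the real part of the character sum at
  \<open>i - j\<close> plus the imaginary part of the one at \<open>i + j\<close>. Character sums
  are real, so the latter is 0 even when \<open>N\<close> divides \<open>i + j\<close>.\<close>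

lemma sum_cas_mult:
  fixes i j :: int
  assumes "0 < N"
  shows "(\<Sum>k=1..N. (cos (2 * pi * i * real k / N) + sin (2 * pi * i * real k / N)) *
           (cos (2 * pi * j * real k / N) + sin (2 * pi * j * real k / N))) =
         (if int N dvd i - j then real N else 0)"
proof -
  have "(\<Sum>k=1..N. cos (2 * pi * (i - j) * real k / N)) = (if int N dvd i - j then real N else 0)"
    using arg_cong[OF sum_cis_multiples[OF assms, of "i - j"], of Re] by (simp split: if_splits)
  moreover have "(\<Sum>k=1..N. sin (2 * pi * (i + j) * real k / N)) = 0"
    using arg_cong[OF sum_cis_multiples[OF assms, of "i + j"], of Im] by (simp split: if_splits)
  ultimately show ?thesis
    unfolding cas_mult
    by (simp add: sum.distrib algebra_simps diff_divide_distrib add_divide_distrib)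
qed

text \<open>The interval from \<open>-m\<close> to \<open>m\<close> has \<open>2 * m + 1\<close>
  elements: \<open>d\<close> for odd \<open>d\<close>, one too many for even \<open>d\<close>, where
  dropping 0 keeps the symmetry. The bound on differences yields incongruence modulo any
  \<open>N > d\<close>.\<close>

lemma ex_symmetric_int_set:
  obtains F :: "int set" where "finite F" "card F = d" "uminus ` F = F"
    "\<And>i j. i \<in> F \<Longrightarrow> j \<in> F \<Longrightarrow> \<bar>i - j\<bar> \<le> int d"
proof -
  define m where "m = int (d div 2)"
  define F where "F = {-m..m} - (if even d then {0} else {})"
  show thesis
  proof
    show "finite F" by (simp add: F_def)
    show "card F = d"
      unfolding F_def m_def by (cases "even d") (auto elim!: evenE oddE simp: card_Diff_subset)
    have "- x \<in> F" if "x \<in> F" for x using that by (auto simp: F_def)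
    then show "uminus ` F = F" by (force simp: image_iff)
    show "\<bar>i - j\<bar> \<le> int d" if "i \<in> F" "j \<in> F" for i j
    proof -
      have "2 * m \<le> int d" unfolding m_def by linarith
      then show ?thesis using that by (auto simp: F_def split: if_splits)
    qed
  qed
qed

lemma sum_odd_eq_0:
  fixes f :: "int \<Rightarrow> real"
  assumes "uminus ` F = F" and "\<And>x. f (- x) = - f x"
  shows "sum f F = 0"
proof -
  have "sum f F = sum f (uminus ` F)" using assms(1) by simp
  also have "\<dots> = (\<Sum>x\<in>F. f (- x))" by (simp add: sum.reindex)
  also have "\<dots> = - sum f F" by (simp add: assms(2) sum_negf)
  finally show ?thesis by simp
qed

lemma ex_uniform_tight_frame:
  assumes "CARD('d::finite) < N" and "0 < c"
  shows "\<exists>v :: nat \<Rightarrow> real ^ 'd. uniform_tight_frame N c v"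
proof -
  let ?d = "CARD('d)"
  obtain F :: "int set" where F: "finite F" "card F = ?d" "uminus ` F = F"
    "\<And>i j. i \<in> F \<Longrightarrow> j \<in> F \<Longrightarrow> \<bar>i - j\<bar> \<le> int ?d"
    using ex_symmetric_int_set by blast
  obtain h :: "'d \<Rightarrow> int" where h: "bij_betw h UNIV F"
    using F(1,2) finite_same_card_bij by (metis finite)
  have N: "0 < N" using assms(1) by simp
  define a where "a i k = cos (2 * pi * of_int i * real k / N) + sin (2 * pi * of_int i * real k / N)"
    for i :: int and k :: nat
  \<comment> \<open>The squares of \<open>a (h i) k\<close> will sum over \<open>i\<close> to
    \<open>?d\<close> for every \<open>k\<close>, so dividing by \<open>sqrt ?d\<close> gives norm
    \<open>c\<close>.\<close>
  define v :: "nat \<Rightarrow> real ^ 'd" where "v k = (\<chi> i. c / sqrt ?d * a (h i) k)" for k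
  have orth: "(\<Sum>k=1..N. a (h i) k * a (h j) k) = (if i = j then real N else 0)" for i j
  proof -
    have "int N dvd h i - h j \<longleftrightarrow> i = j"
    proof
      assume "int N dvd h i - h j"
      moreover have "\<bar>h i - h j\<bar> < int N"
        using F(4)[of "h i" "h j"] h assms(1) by (fastforce simp: bij_betw_def)
      ultimately have "h i - h j = 0"
        by (metis dvd_imp_le_int abs_of_nat not_le)
      then show "i = j" using h by (auto simp: bij_betw_def inj_on_def)
    qed simp
    then show ?thesis unfolding a_def using sum_cas_mult[OF N, of "h i" "h j"] by simp
  qed
  have "(norm (v k))\<^sup>2 = c\<^sup>2" for k
  proof -
    \<comment> \<open>The sine term is odd in \<open>i\<close>, so it cancels over the symmetric set
      \<open>F\<close> and only the count of \<open>F\<close> remains.\<close>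
    have sq: "(a i k)\<^sup>2 = 1 + sin (2 * (2 * pi * i * real k / N))" for i
      unfolding a_def power2_eq_square cas_mult by simp
    have "(norm (v k))\<^sup>2 = c\<^sup>2 / ?d * (\<Sum>i\<in>UNIV. (a (h i) k)\<^sup>2)"
      unfolding power2_norm_eq_inner inner_vec_def
      by (simp add: v_def sum_distrib_left power2_eq_square field_simps)
    also have "(\<Sum>i\<in>UNIV. (a (h i) k)\<^sup>2) = (\<Sum>i\<in>F. (a i k)\<^sup>2)"
      using sum.reindex_bij_betw[OF h] .
    also have "\<dots> = ?d"
      unfolding sq using sum_odd_eq_0[OF F(3), of "\<lambda>i. sin (2 * (2 * pi * i * real k / N))"] F(2)
      by (simp add: sum.distrib)
    finally show ?thesis by simp
  qed
  then have norm: "norm (v k) = c" for k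
    using assms(2) by (metis norm_ge_zero less_imp_le power2_eq_iff_nonneg)
  have "(\<Sum>k=1..N. rank_one (v k) (v k) z) = (real N * c\<^sup>2 / ?d) *\<^sub>R z" for z
  proof (rule vec_eq_iff[THEN iffD2], rule allI)
    fix i
    have "(\<Sum>k=1..N. rank_one (v k) (v k) z) $ i =
        (\<Sum>k=1..N. \<Sum>j\<in>UNIV. c\<^sup>2 / ?d * z $ j * (a (h i) k * a (h j) k))"
      by (simp add: rank_one_def inner_vec_def v_def sum_distrib_left sum_distrib_right power2_eq_square field_simps)
    also have "\<dots> = (\<Sum>j\<in>UNIV. c\<^sup>2 / ?d * z $ j * (\<Sum>k=1..N. a (h i) k * a (h j) k))"
      by (subst sum.swap) (simp add: sum_distrib_left)
    also have "\<dots> = c\<^sup>2 / ?d * z $ i * N"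
      unfolding orth by (simp add: if_distrib cong: if_cong)
    finally show "(\<Sum>k=1..N. rank_one (v k) (v k) z) $ i = ((real N * c\<^sup>2 / ?d) *\<^sub>R z) $ i"
      by (simp add: field_simps)
  qed
  then show ?thesis
    using norm assms(2) unfolding uniform_tight_frame_def by blast
qed

section \<open>Frame potential and interference\<close>

lemma sum_inner_squared_eq:
  fixes v :: "'k \<Rightarrow> real ^ 'd::finite"
  shows "(\<Sum>k\<in>K. \<Sum>l\<in>K. (v k \<bullet> v l)\<^sup>2) = (\<Sum>i\<in>UNIV. \<Sum>j\<in>UNIV. (\<Sum>k\<in>K. v k $ i * v k $ j)\<^sup>2)"
proof -
  \<comment> \<open>Both sides are squared Frobenius norms, of the Gram matrix on the left and of
    the frame operator on the right.\<close>
  have "(\<Sum>k\<in>K. \<Sum>l\<in>K. (v k \<bullet> v l)\<^sup>2) =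
      (\<Sum>k\<in>K. \<Sum>l\<in>K. \<Sum>i\<in>UNIV. \<Sum>j\<in>UNIV. v k $ i * v l $ i * (v k $ j * v l $ j))"
    by (simp add: power2_eq_square inner_vec_def sum_product)
  also have "\<dots> = (\<Sum>k\<in>K. \<Sum>i\<in>UNIV. \<Sum>l\<in>K. \<Sum>j\<in>UNIV. v k $ i * v l $ i * (v k $ j * v l $ j))"
    by (intro sum.cong refl sum.swap)
  also have "\<dots> = (\<Sum>i\<in>UNIV. \<Sum>k\<in>K. \<Sum>j\<in>UNIV. \<Sum>l\<in>K. v k $ i * v l $ i * (v k $ j * v l $ j))"
    by (subst sum.swap) (intro sum.cong refl sum.swap)
  also have "\<dots> = (\<Sum>i\<in>UNIV. \<Sum>j\<in>UNIV. \<Sum>k\<in>K. \<Sum>l\<in>K. v k $ i * v l $ i * (v k $ j * v l $ j))"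
    by (intro sum.cong refl sum.swap)
  finally show ?thesis
    by (simp add: power2_eq_square sum_product mult_ac)
qed

text \<open>The matrix \<open>?S\<close> of the frame operator has trace equal to the sum of the
  squared norms. Cauchy-Schwarz is applied to its diagonal entries; the off-diagonal squares only
  add.\<close>

lemma frame_potential_ge:
  fixes v :: "'k \<Rightarrow> real ^ 'd::finite"
  shows "(\<Sum>k\<in>K. (norm (v k))\<^sup>2)\<^sup>2 / CARD('d) \<le> (\<Sum>k\<in>K. \<Sum>l\<in>K. (v k \<bullet> v l)\<^sup>2)"
proof -
  let ?S = "\<lambda>i j. \<Sum>k\<in>K. v k $ i * v k $ j"
  have "(\<Sum>k\<in>K. (norm (v k))\<^sup>2) = (\<Sum>i\<in>UNIV. ?S i i)"
    unfolding power2_norm_eq_inner inner_vec_def inner_real_def by (rule sum.swap)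
  then have "(\<Sum>k\<in>K. (norm (v k))\<^sup>2)\<^sup>2 \<le> (\<Sum>i\<in>UNIV. (?S i i)\<^sup>2) * CARD('d)"
    using sum_squared_le_sum_of_squares[of "\<lambda>i. ?S i i" "UNIV :: 'd set"] by simp
  then have "(\<Sum>k\<in>K. (norm (v k))\<^sup>2)\<^sup>2 / CARD('d) \<le> (\<Sum>i\<in>UNIV. (?S i i)\<^sup>2)"
    by (simp add: divide_le_eq)
  also have "\<dots> \<le> (\<Sum>i\<in>UNIV. \<Sum>j\<in>UNIV. (?S i j)\<^sup>2)"
    by (intro sum_mono) (rule member_le_sum[where f = "\<lambda>j. (?S _ j)\<^sup>2"], auto)
  finally show ?thesis by (simp add: sum_inner_squared_eq)
qed

lemma sum_inner_squared_remove:
  fixes v :: "nat \<Rightarrow> 'a::real_inner"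
  assumes "k \<in> {1..N}" and "(norm (v k))\<^sup>2 = c"
  shows "(\<Sum>l\<in>{1..N} - {k}. (v k \<bullet> v l)\<^sup>2) = (\<Sum>l=1..N. (v k \<bullet> v l)\<^sup>2) - c\<^sup>2"
  using assms sum.remove[of "{1..N}" k "\<lambda>l. (v k \<bullet> v l)\<^sup>2"]
  by (simp add: power2_norm_eq_inner)

text \<open>Averaging, with \<open>c\<close> the squared norm: if every interference fell short,
  restoring the diagonal terms \<open>c\<^sup>2\<close> and summing over \<open>k\<close> would push
  the frame potential below its lower bound.\<close>

lemma ex_sum_inner_squared_ge:
  fixes v :: "nat \<Rightarrow> real ^ 'd::finite"
  assumes "0 < N" and "\<And>k. k \<in> {1..N} \<Longrightarrow> (norm (v k))\<^sup>2 = c"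
  shows "\<exists>k\<in>{1..N}. c\<^sup>2 * ((real N - CARD('d)) / CARD('d)) \<le> (\<Sum>l\<in>{1..N} - {k}. (v k \<bullet> v l)\<^sup>2)"
proof (rule ccontr)
  assume neg: "\<not> ?thesis"
  have less: "(\<Sum>l=1..N. (v k \<bullet> v l)\<^sup>2) < N * c\<^sup>2 / CARD('d)" if k: "k \<in> {1..N}" for k
  proof -
    have "(\<Sum>l\<in>{1..N} - {k}. (v k \<bullet> v l)\<^sup>2) < c\<^sup>2 * ((real N - CARD('d)) / CARD('d))"
      using neg k by (auto simp: not_le)
    also have "c\<^sup>2 * ((real N - CARD('d)) / CARD('d)) = N * c\<^sup>2 / CARD('d) - c\<^sup>2"
      by (simp add: field_simps)
    finally show ?thesis
      using sum_inner_squared_remove[where v = v, OF k assms(2)[OF k]] by simp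
  qed
  have "(\<Sum>k=1..N. \<Sum>l=1..N. (v k \<bullet> v l)\<^sup>2) < (\<Sum>k=1..N. N * c\<^sup>2 / CARD('d))"
    using assms(1) by (intro sum_strict_mono less) auto
  also have "\<dots> = (\<Sum>k=1..N. (norm (v k))\<^sup>2)\<^sup>2 / CARD('d)"
    using assms(2) by (simp add: power2_eq_square)
  finally show False using frame_potential_ge[of v "{1..N}"] by simp
qed

text \<open>Pair the frame identity at \<open>v k\<close> with \<open>v k\<close> and remove the
  diagonal term. Here \<open>c\<close> is the norm itself, whence the fourth power.\<close>

lemma uniform_tight_frame_sum_inner_squared:
  fixes v :: "nat \<Rightarrow> real ^ 'd::finite"
  assumes "uniform_tight_frame N c v" and "k \<in> {1..N}"
  shows "(\<Sum>l\<in>{1..N} - {k}. (v k \<bullet> v l)\<^sup>2) = (c\<^sup>2)\<^sup>2 * ((real N - CARD('d)) / CARD('d))"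
proof -
  have n: "(norm (v k))\<^sup>2 = c\<^sup>2" and
    f: "(\<Sum>l=1..N. rank_one (v l) (v l) (v k)) = (real N * c\<^sup>2 / CARD('d)) *\<^sub>R v k"
    using assms unfolding uniform_tight_frame_def by (auto dest: fun_cong)
  have "(\<Sum>l=1..N. (v k \<bullet> v l)\<^sup>2) = v k \<bullet> (\<Sum>l=1..N. rank_one (v l) (v l) (v k))"
    by (simp add: inner_sum_right rank_one_def power2_eq_square)
  also have "\<dots> = real N * c\<^sup>2 / CARD('d) * c\<^sup>2"
    unfolding f using n by (simp add: power2_norm_eq_inner)
  finally have "(\<Sum>l\<in>{1..N} - {k}. (v k \<bullet> v l)\<^sup>2) = real N * c\<^sup>2 / CARD('d) * c\<^sup>2 - (c\<^sup>2)\<^sup>2"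
    using sum_inner_squared_remove[where v = v, OF assms(2) n] by simp
  then show ?thesis
    by (simp add: field_simps power2_eq_square)
qed

section \<open>Monotonicity in the squared norm and optimality\<close>

lemma ratio_antimono:
  fixes a c c1 s :: real
  assumes "0 < a" and "0 < c1" and "c1 \<le> c" and "s\<^sup>2 \<le> c1\<^sup>2 * a"
  shows "c / (s\<^sup>2 + c\<^sup>2 * a) \<le> c1 / (s\<^sup>2 + c1\<^sup>2 * a)"
proof -
  have "c1\<^sup>2 * a \<le> c * c1 * a"
    using assms by (simp add: power2_eq_square)
  with assms(4) have "s\<^sup>2 \<le> c * c1 * a"
    by (rule order_trans)
  \<comment> \<open>This product is the difference of the two sides after
    cross-multiplication.\<close>
  then have "0 \<le> (c - c1) * (c * c1 * a - s\<^sup>2)"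
    using assms by (intro mult_nonneg_nonneg) auto
  then have "c * (s\<^sup>2 + c1\<^sup>2 * a) \<le> c1 * (s\<^sup>2 + c\<^sup>2 * a)"
    by (simp add: algebra_simps power2_eq_square)
  moreover have "0 < s\<^sup>2 + c\<^sup>2 * a" "0 < s\<^sup>2 + c1\<^sup>2 * a"
    using assms by (auto intro!: add_nonneg_pos)
  ultimately show ?thesis by (simp add: frac_le_eq divide_le_eq field_simps)
qed

theorem theorem2:
  fixes c1 c2 \<sigma> :: real and N :: nat
  assumes "2 \<le> CARD('d::finite)" and "CARD('d) < N"
    and "0 < c1" and "c1 < c2"
    and "0 \<le> \<sigma>"
    and "\<sigma> \<le> c1 * sqrt ((real N - real CARD('d)) / real CARD('d))"
  shows "\<exists>v :: nat \<Rightarrow> real ^ 'd.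
           uniform_tight_frame N (sqrt c1) v \<and>
           is_arg_max (min_ratio N \<sigma>) (\<lambda>w. w \<in> admissible_systems N c1 c2) v"
proof -
  define a where "a = (real N - CARD('d)) / CARD('d)"
  have a: "0 < a" using assms(2) by (simp add: a_def)
  have "\<sigma>\<^sup>2 \<le> (c1 * sqrt a)\<^sup>2"
    using assms(5,6) unfolding a_def by (intro power_mono)
  then have \<sigma>: "\<sigma>\<^sup>2 \<le> c1\<^sup>2 * a" using a by (simp add: power_mult_distrib)
  obtain v :: "nat \<Rightarrow> real ^ 'd" where v: "uniform_tight_frame N (sqrt c1) v"
    using ex_uniform_tight_frame[OF assms(2)] assms(3) by force
  have normv: "norm (v k) = sqrt c1" if "k \<in> {1..N}" for k
    using v that by (simp add: uniform_tight_frame_def)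
  have adm: "v \<in> admissible_systems N c1 c2"
    using normv assms(3,4) unfolding admissible_systems_def uniform_system_def
    by (auto intro!: exI[of _ "sqrt c1"] bexI[of _ c1])
  \<comment> \<open>Since \<open>a\<close> is positive, the denominator is positive even for
    \<open>\<sigma> = 0\<close>, and the \<open>ereal\<close> quotient is a real one.\<close>
  have D1: "0 < \<sigma>\<^sup>2 + c1\<^sup>2 * a" using a assms(3) by (simp add: add_nonneg_pos)
  have "ereal ((norm (v k))\<^sup>2) / ereal (\<sigma>\<^sup>2 + (\<Sum>l\<in>{1..N} - {k}. (v k \<bullet> v l)\<^sup>2)) =
      ereal (c1 / (\<sigma>\<^sup>2 + c1\<^sup>2 * a))" if "k \<in> {1..N}" for k
    using uniform_tight_frame_sum_inner_squared[OF v that] normv[OF that] D1 assms(3)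
    by (simp add: a_def)
  then have "(\<lambda>k. ereal ((norm (v k))\<^sup>2) / ereal (\<sigma>\<^sup>2 + (\<Sum>l\<in>{1..N} - {k}. (v k \<bullet> v l)\<^sup>2))) ` {1..N} =
      {ereal (c1 / (\<sigma>\<^sup>2 + c1\<^sup>2 * a))}"
    using assms(2) by (force simp: image_iff)
  then have minv: "min_ratio N \<sigma> v = ereal (c1 / (\<sigma>\<^sup>2 + c1\<^sup>2 * a))"
    unfolding min_ratio_def by simp
  have "min_ratio N \<sigma> w \<le> min_ratio N \<sigma> v" if adm_w: "w \<in> admissible_systems N c1 c2" for w :: "nat \<Rightarrow> real ^ 'd"
  proof -
    obtain c where c: "c1 \<le> c" and w: "\<And>k. k \<in> {1..N} \<Longrightarrow> norm (w k) = sqrt c"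
      using adm_w unfolding admissible_systems_def by auto
    have c0: "0 < c" using c assms(3) by simp
    have w2: "(norm (w k))\<^sup>2 = c" if "k \<in> {1..N}" for k
      using w[OF that] c0 by simp
    \<comment> \<open>One index with large interference suffices, because the minimum is at most the
      quotient there.\<close>
    obtain k where k: "k \<in> {1..N}" and
      ge: "c\<^sup>2 * a \<le> (\<Sum>l\<in>{1..N} - {k}. (w k \<bullet> w l)\<^sup>2)" (is "_ \<le> ?S")
      using ex_sum_inner_squared_ge[of N w c, OF _ w2] assms(2) unfolding a_def by auto
    have D: "0 < \<sigma>\<^sup>2 + c\<^sup>2 * a" using a c0 by (simp add: add_nonneg_pos)
    have "min_ratio N \<sigma> w \<le> ereal ((norm (w k))\<^sup>2) / ereal (\<sigma>\<^sup>2 + ?S)"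
      unfolding min_ratio_def using k by (intro Min_le) auto
    also have "\<dots> = ereal (c / (\<sigma>\<^sup>2 + ?S))"
      using w2[OF k] D ge by simp
    also have "\<dots> \<le> ereal (c / (\<sigma>\<^sup>2 + c\<^sup>2 * a))"
      using D ge c0 by (simp add: frac_le)
    also have "\<dots> \<le> ereal (c1 / (\<sigma>\<^sup>2 + c1\<^sup>2 * a))"
      using ratio_antimono[OF a assms(3) c \<sigma>] by simp
    finally show ?thesis by (simp add: minv)
  qed
  then show ?thesis
    using v adm unfolding is_arg_max_def by (auto simp: not_less)
qed

end
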